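(* Let $\mathfrak A$ be an HTM and $\mathcal Q$ be a $\sigma$-ring. Then $\mathcal M(\mathcal Q,\mathfrak A)$ is a monoid whose neutral element is the constant map $\mathbf 0_{\mathfrak A}(\mathcal Q)$ on $\mathcal Q$ with value $0_{\mathfrak A}$.
   Context: Monoids are Abelian and written additively. An HTM is a monoid with a Hausdorff topology making addition continuous. For a map $f$, $D_f$ denotes its domain. "Countable" includes finite and empty. A ring (of sets) is a nonempty set $\mathcal Q$ of sets such that $A\cup B\in\mathcal Q$ and $A\setminus B\in\mathcal Q$ for all $A,B\in\mathcal Q$. A $\delta$-ring is a ring closed under intersections of nonempty countable families; a $\sigma$-ring is a ring closed under countable unions. For a set of sets $\mathcal K$, $\sigma(\mathcal K)$ is the smallest $\sigma$-ring containing $\mathcal K$. A family $\mathbf A\colon I\to\mathcal Q$ is a partition of $A$ (into elements of $\mathcal Q$) if $\mathbf A(i)\cap\mathbf A(j)=\varnothing$ for $i\ne j$ and $\bigcup_{i\in I}\mathbf A(i)=A$ (members may be empty and $I$ may be empty); it is countable if $I$ is countable. A family $f\colon I\to\mathfrak A$ is summable in $\mathfrak A$ if the net $J\mapsto\sum_{i\in J}f(i)$ over the finite subsets $J\subset I$, directed by inclusion, converges in $\mathfrak A$; its limit is denoted $\sum f$. An $\mathfrak A$-valued premeasure is a map $\mu\colon D_\mu\to\mathfrak A$ whose domain $D_\mu$ is a $\delta$-ring and such that for every $A\in D_\mu$ and every countable partition $\mathbf A$ of $A$ into elements of $D_\mu$, the family $\mu\circ\mathbf A$ is summable in $\mathfrak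 A$ and $\mu(A)=\sum\mu\circ\mathbf A$. The host $\sigma$-ring of a map $\mu$ is $\mathscr H[\mu]=\sigma(D_\mu)$. Maps $\mu,\nu$ are similar, $\mu\asymp\nu$, if $\mathscr H[\mu]=\mathscr H[\nu]$ and $\mu,\nu$ coincide on $D_\mu\cap D_\nu$. An $\mathfrak A$-valued measure is an $\mathfrak A$-valued premeasure $\mu$ which is an extension of every $\mathfrak A$-valued premeasure $\nu$ with $\nu\asymp\mu$. For every $\mathfrak A$-valued premeasure $\mu$ there is a unique $\mathfrak A$-valued measure similar to $\mu$; it is denoted $[\![\mu]\!]_{\mathfrak A}$. $\mathcal M(\mathcal Q,\mathfrak A)$ is the set of all $\mathfrak A$-valued measures $\mu$ with $\mathscr H[\mu]=\mathcal Q$, endowed with the addition $\mu+\nu=[\![\mu\dotplus\nu]\!]_{\mathfrak A}$, where $\mu\dotplus\nu$ is the pointwise sum of $\mu$ and $\nu$ defined on $D_\mu\cap D_\nu$ (this is an $\mathfrak A$-valued premeasure with host $\sigma$-ring $\mathcal Q$). *)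

theory Defs
  imports
    "HOL-Analysis.Sigma_Algebra"
    "HOL-Analysis.Infinite_Sum"
    "HOL-Algebra.Group"
begin

text \<open>
  A Hausdorff topological monoid is a type of sort
  \<open>{topological_comm_monoid_add, t2_space}\<close>. Rings of sets have no ambient space here, so the
  library predicate \<open>ring_of_sets\<close> is used with \<open>UNIV\<close> as its space.
\<close>

lemma ring_of_sets_UNIV_iff:
  "ring_of_sets UNIV Q \<longleftrightarrow> Q \<noteq> {} \<and> (\<forall>A\<in>Q. \<forall>B\<in>Q. A \<union> B \<in> Q \<and> A - B \<in> Q)"
proof -
  have "{} \<in> Q" if "A \<in> Q" "\<forall>A\<in>Q. \<forall>B\<in>Q. A - B \<in> Q" for A
  proof -
    have "A - A \<in> Q" using that by blast
    then show ?thesis by simp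
  qed
  then show ?thesis unfolding ring_of_sets_iff by blast
qed

definition delta_ring :: "'b set set \<Rightarrow> bool" where
  "delta_ring Q \<longleftrightarrow> ring_of_sets UNIV Q \<and> (\<forall>C. C \<subseteq> Q \<and> countable C \<and> C \<noteq> {} \<longrightarrow> \<Inter>C \<in> Q)"

definition sigma_ring :: "'b set set \<Rightarrow> bool" where
  "sigma_ring Q \<longleftrightarrow> ring_of_sets UNIV Q \<and> (\<forall>C. C \<subseteq> Q \<and> countable C \<longrightarrow> \<Union>C \<in> Q)"

definition is_partition :: "'b set set \<Rightarrow> 'b set \<Rightarrow> 'i set \<Rightarrow> ('i \<Rightarrow> 'b set) \<Rightarrow> bool" where
  "is_partition Q A I P \<longleftrightarrow> P ` I \<subseteq> Q \<and> disjoint_family_on P I \<and> \<Union>(P ` I) = A"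

text \<open>
  A map defined on a set of sets is a partial map \<open>'b set \<rightharpoonup> 'a\<close>, with \<open>D\<^sub>\<mu> = dom \<mu>\<close>; extension of
  maps is \<open>\<subseteq>\<^sub>m\<close>. Countable index sets are taken among the subsets of \<open>nat\<close>
  (finite and empty ones included); lemma \<open>premeasure_countable_partition\<close> below gives arbitrary
  countable index sets.
\<close>

definition premeasure :: "('b set \<rightharpoonup> 'a::{topological_comm_monoid_add, t2_space}) \<Rightarrow> bool" where
  "premeasure \<mu> \<longleftrightarrow> delta_ring (dom \<mu>) \<and>
     (\<forall>A\<in>dom \<mu>. \<forall>(I::nat set) P. is_partition (dom \<mu>) A I P \<longrightarrow>
        ((\<lambda>i. the (\<mu> (P i))) has_sum the (\<mu> A)) I)"

lemma premeasure_countable_partition: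
  fixes I :: "'i set"
  assumes "premeasure \<mu>" "A \<in> dom \<mu>" "countable I" "is_partition (dom \<mu>) A I P"
  shows "((\<lambda>i. the (\<mu> (P i))) has_sum the (\<mu> A)) I"
proof -
  define h where "h = from_nat_into I"
  define J where "J = to_nat_on I ` I"
  have inj: "inj_on (to_nat_on I) I"
    using assms(3) by (rule inj_on_to_nat_on)
  have hI: "h (to_nat_on I i) = i" if "i \<in> I" for i
    using that assms(3) by (simp add: h_def)
  have "is_partition (dom \<mu>) A J (P \<circ> h)"
    using assms(4) hI inj unfolding is_partition_def J_def disjoint_family_on_def
    by (auto simp: image_image) (metis IntI empty_iff)
  then have "((\<lambda>j. the (\<mu> ((P \<circ> h) j))) has_sum the (\<mu> A)) J"
    using assms(1,2) unfolding premeasure_def by blast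
  then have "((\<lambda>j. the (\<mu> ((P \<circ> h) j))) \<circ> to_nat_on I has_sum the (\<mu> A)) I"
    unfolding J_def by (simp add: has_sum_reindex[OF inj])
  then show ?thesis
    by (rule has_sum_cong[THEN iffD1, rotated]) (simp add: hI)
qed

definition host :: "('b set \<rightharpoonup> 'a) \<Rightarrow> 'b set set" where
  "host \<mu> = sigma_ring hull (dom \<mu>)"

definition similar :: "('b set \<rightharpoonup> 'a) \<Rightarrow> ('b set \<rightharpoonup> 'a) \<Rightarrow> bool" (infix \<open>\<asymp>\<close> 50) where
  "\<mu> \<asymp> \<nu> \<longleftrightarrow> host \<mu> = host \<nu> \<and> (\<forall>A \<in> dom \<mu> \<inter> dom \<nu>. \<mu> A = \<nu> A)"

definition is_measure :: "('b set \<rightharpoonup> 'a::{topological_comm_monoid_add, t2_space}) \<Rightarrow> bool" where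
  "is_measure \<mu> \<longleftrightarrow> premeasure \<mu> \<and> (\<forall>\<nu>. premeasure \<nu> \<and> \<nu> \<asymp> \<mu> \<longrightarrow> \<nu> \<subseteq>\<^sub>m \<mu>)"

text \<open>Only meaningful when \<open>\<mu>\<close> is a premeasure; the measure similar to \<open>\<mu>\<close> is then unique.\<close>

definition measure_ext ::
  "('b set \<rightharpoonup> 'a::{topological_comm_monoid_add, t2_space}) \<Rightarrow> ('b set \<rightharpoonup> 'a)" where
  "measure_ext \<mu> = (THE \<nu>. is_measure \<nu> \<and> \<nu> \<asymp> \<mu>)"

definition pointwise_add ::
  "('b set \<rightharpoonup> 'a::plus) \<Rightarrow> ('b set \<rightharpoonup> 'a) \<Rightarrow> ('b set \<rightharpoonup> 'a)" where
  "pointwise_add \<mu> \<nu> =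
     (\<lambda>A. if A \<in> dom \<mu> \<inter> dom \<nu> then Some (the (\<mu> A) + the (\<nu> A)) else None)"

definition zero_on :: "'b set set \<Rightarrow> ('b set \<rightharpoonup> 'a::zero)" where
  "zero_on Q = (\<lambda>A. if A \<in> Q then Some 0 else None)"

definition host_measures ::
  "'b set set \<Rightarrow> ('b set \<rightharpoonup> 'a::{topological_comm_monoid_add, t2_space}) set" where
  "host_measures Q = {\<mu>. is_measure \<mu> \<and> host \<mu> = Q}"

definition measure_add ::
  "('b set \<rightharpoonup> 'a::{topological_comm_monoid_add, t2_space}) \<Rightarrow> ('b set \<rightharpoonup> 'a) \<Rightarrow> ('b set \<rightharpoonup> 'a)" where
  "measure_add \<mu> \<nu> = measure_ext (pointwise_add \<mu> \<nu>)"

end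

theory Submission
  imports Defs
begin

text \<open>
  A \<open>\<delta>\<close>-ring is an ideal of the \<open>\<sigma>\<close>-ring \<open>\<Q>\<close> it generates, so finitely many \<open>\<delta>\<close>-rings generating
  \<open>\<Q>\<close> have an intersection that still generates \<open>\<Q>\<close>; hence similarity is transitive on premeasures.
  Two similar premeasures have a common similar extension, \<open>A \<union> B \<mapsto> \<mu> A + \<nu> B\<close> for disjoint \<open>A\<close> and
  \<open>B\<close>, so the premeasures similar to \<open>\<mu>\<close> form a directed set. Their union is again a premeasure,
  because every partition of a set \<open>A\<close> of some domain already consists of elements of that domain;
  this avoids iterated sums, which misbehave when the topology is not regular. The union is the
  measure similar to \<open>\<mu>\<close>, and the monoid laws hold because both sides are measures similar to the
  same premeasure.
\<close>

section \<open>\<open>\<delta>\<close>-rings as ideals of \<open>\<sigma>\<close>-rings\<close>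

lemma
  assumes D: "delta_ring D"
  shows delta_ring_empty: "{} \<in> D"
    and delta_ring_Un: "A \<in> D \<Longrightarrow> B \<in> D \<Longrightarrow> A \<union> B \<in> D"
    and delta_ring_Diff: "A \<in> D \<Longrightarrow> B \<in> D \<Longrightarrow> A - B \<in> D"
    and delta_ring_Inter: "C \<subseteq> D \<Longrightarrow> countable C \<Longrightarrow> C \<noteq> {} \<Longrightarrow> \<Inter>C \<in> D"
proof -
  interpret ring_of_sets UNIV D using D by (simp add: delta_ring_def)
  show "{} \<in> D" by (rule empty_sets)
  show "A \<union> B \<in> D" if "A \<in> D" "B \<in> D" using that by (rule Un)
  show "A - B \<in> D" if "A \<in> D" "B \<in> D" using that by (rule Diff)
  show "\<Inter>C \<in> D" if "C \<subseteq> D" "countable C" "C \<noteq> {}" using D that unfolding delta_ring_def by blast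
qed

lemma
  assumes Q: "sigma_ring Q"
  shows sigma_ring_empty: "{} \<in> Q"
    and sigma_ring_Un: "A \<in> Q \<Longrightarrow> B \<in> Q \<Longrightarrow> A \<union> B \<in> Q"
    and sigma_ring_Diff: "A \<in> Q \<Longrightarrow> B \<in> Q \<Longrightarrow> A - B \<in> Q"
    and sigma_ring_Union: "C \<subseteq> Q \<Longrightarrow> countable C \<Longrightarrow> \<Union>C \<in> Q"
proof -
  interpret ring_of_sets UNIV Q using Q by (simp add: sigma_ring_def)
  show "{} \<in> Q" by (rule empty_sets)
  show "A \<union> B \<in> Q" if "A \<in> Q" "B \<in> Q" using that by (rule Un)
  show "A - B \<in> Q" if "A \<in> Q" "B \<in> Q" using that by (rule Diff)
  show "\<Union>C \<in> Q" if "C \<subseteq> Q" "countable C" using Q that unfolding sigma_ring_def by blast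
qed

lemma delta_ringI:
  assumes "{} \<in> D"
    and "\<And>A B. A \<in> D \<Longrightarrow> B \<in> D \<Longrightarrow> A \<union> B \<in> D"
    and "\<And>A B. A \<in> D \<Longrightarrow> B \<in> D \<Longrightarrow> A - B \<in> D"
    and "\<And>C. C \<subseteq> D \<Longrightarrow> countable C \<Longrightarrow> C \<noteq> {} \<Longrightarrow> \<Inter>C \<in> D"
  shows "delta_ring D"
proof -
  have "D \<noteq> {}" using assms(1) by blast
  then show ?thesis
    unfolding delta_ring_def ring_of_sets_UNIV_iff
    by (intro conjI ballI allI impI) (simp_all add: assms(2-4))
qed

lemma sigma_ringI:
  assumes Diff: "\<And>A B. A \<in> Q \<Longrightarrow> B \<in> Q \<Longrightarrow> A - B \<in> Q"
    and Union: "\<And>C. C \<subseteq> Q \<Longrightarrow> countable C \<Longrightarrow> \<Union>C \<in> Q"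
  shows "sigma_ring Q"
proof -
  have "A \<union> B \<in> Q" if "A \<in> Q" "B \<in> Q" for A B
    using Union[of "{A, B}"] that by simp
  moreover have "Q \<noteq> {}" using Union[of "{}"] by auto
  ultimately show ?thesis
    unfolding sigma_ring_def ring_of_sets_UNIV_iff
    by (intro conjI ballI allI impI) (simp_all add: Diff Union)
qed

text \<open>For \<open>A\<close> in \<open>C\<close>, \<open>\<Inter>C\<close> is \<open>A\<close>
  minus the countable union of the sets \<open>A - c\<close>, hence lies in \<open>Q\<close>, and
  the ideal property brings it into \<open>J\<close>. Domains built later thus only need closure
  under binary unions and under subsets from \<open>Q\<close>.\<close>

lemma delta_ring_ideal:
  assumes Q: "sigma_ring Q" and JQ: "J \<subseteq> Q" and ne: "{} \<in> J"
    and Un: "\<And>A B. A \<in> J \<Longrightarrow> B \<in> J \<Longrightarrow> A \<union> B \<in> J"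
    and ideal: "\<And>A B. A \<in> J \<Longrightarrow> B \<in> Q \<Longrightarrow> B \<subseteq> A \<Longrightarrow> B \<in> J"
  shows "delta_ring J"
proof -
  have "A - B \<in> J" if "A \<in> J" "B \<in> J" for A B
    using ideal[OF that(1) sigma_ring_Diff[OF Q]] that JQ by blast
  moreover have "\<Inter>C \<in> J" if C: "C \<subseteq> J" "countable C" "C \<noteq> {}" for C
  proof -
    obtain A where A: "A \<in> C" using C by blast
    have "(-) A ` C \<subseteq> Q" using C A JQ sigma_ring_Diff[OF Q] by blast
    then have "A - \<Union>((-) A ` C) \<in> Q"
      using C A JQ by (intro sigma_ring_Diff[OF Q] sigma_ring_Union[OF Q]) auto
    moreover have "A - \<Union>((-) A ` C) = \<Inter>C" using A by blast
    ultimately have "\<Inter>C \<in> Q" by simp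
    moreover have "A \<in> J" "\<Inter>C \<subseteq> A" using A C by auto
    ultimately show ?thesis using ideal by blast
  qed
  ultimately show ?thesis by (intro delta_ringI ne Un)
qed

lemma sigma_ring_imp_delta_ring: "sigma_ring Q \<Longrightarrow> delta_ring Q"
  by (rule delta_ring_ideal) (auto intro: sigma_ring_empty sigma_ring_Un)

lemma delta_ring_Int:
  assumes D: "delta_ring D" and E: "delta_ring E"
  shows "delta_ring (D \<inter> E)"
  by (rule delta_ringI)
    (simp_all add: delta_ring_empty delta_ring_Un delta_ring_Diff delta_ring_Inter D E)

lemma sigma_ring_hull: "sigma_ring (sigma_ring hull D)"
proof (rule hull_in)
  fix T :: "'a set set set" assume T: "Ball T sigma_ring"
  show "sigma_ring (\<Inter>T)"
  proof (rule sigma_ringI)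
    show "A - B \<in> \<Inter>T" if "A \<in> \<Inter>T" "B \<in> \<Inter>T" for A B
      using T that sigma_ring_Diff by (metis InterE InterI)
    show "\<Union>C \<in> \<Inter>T" if "C \<subseteq> \<Inter>T" "countable C" for C
    proof
      fix X assume X: "X \<in> T"
      then have "C \<subseteq> X" using that by blast
      then show "\<Union>C \<in> X" using T X that(2) by (simp add: sigma_ring_Union)
    qed
  qed
qed

text \<open>By De Morgan inside \<open>A\<close>, \<open>A \<inter> \<Union>C\<close> is
  \<open>A\<close> minus the intersection of the sets \<open>A - c\<close>. That intersection has to
  be nonempty as a family, so \<open>C = {}\<close> is separate.\<close>

lemma delta_ring_Int_countable_Union:
  assumes D: "delta_ring D" and A: "A \<in> D" and C: "C \<subseteq> D" "countable C"
  shows "A \<inter> \<Union>C \<in> D"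
proof (cases "C = {}")
  case True
  then show ?thesis using delta_ring_empty[OF D] by simp
next
  case False
  have "\<Inter>((-) A ` C) \<in> D"
    using C A False by (intro delta_ring_Inter[OF D]) (auto intro: delta_ring_Diff[OF D])
  then have "A - \<Inter>((-) A ` C) \<in> D" by (intro delta_ring_Diff[OF D] A)
  moreover have "A - \<Inter>((-) A ` C) = A \<inter> \<Union>C" using False by auto
  ultimately show ?thesis by simp
qed

text \<open>The countable unions of members of \<open>D\<close> already form a \<sigma>-ring. For
  differences, \<open>\<Union>C - B\<close> is the union of the sets \<open>c - B\<close>, and each
  of these stays in \<open>D\<close> because \<open>c\<close> meets the countable union
  \<open>B\<close> in a member of \<open>D\<close>.\<close>

lemma sigma_ring_hull_countable_Union:
  assumes D: "delta_ring D" and A: "A \<in> sigma_ring hull D"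
  obtains C where "C \<subseteq> D" "countable C" "A = \<Union>C"
proof -
  let ?S = "{\<Union>C |C. C \<subseteq> D \<and> countable C}"
  have Union: "\<Union>X \<in> ?S" if "X \<subseteq> ?S" "countable X" for X
  proof -
    have "\<forall>x\<in>X. \<exists>C. C \<subseteq> D \<and> countable C \<and> x = \<Union>C" using that by blast
    then obtain f where f: "\<forall>x\<in>X. f x \<subseteq> D \<and> countable (f x) \<and> x = \<Union>(f x)" by metis
    have "\<Union>(\<Union>x\<in>X. f x) = (\<Union>x\<in>X. \<Union>(f x))" by blast
    also have "\<dots> = (\<Union>x\<in>X. x)" by (rule SUP_cong) (use f in simp_all)
    finally have "\<Union>X = \<Union>(\<Union>x\<in>X. f x)" by simp
    moreover have "countable (\<Union>x\<in>X. f x)" using f that by auto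
    moreover have "(\<Union>x\<in>X. f x) \<subseteq> D" using f by auto
    ultimately show ?thesis by blast
  qed
  have "sigma_ring ?S"
  proof (rule sigma_ringI)
    fix A B assume AB: "A \<in> ?S" "B \<in> ?S"
    obtain C E where C: "C \<subseteq> D" "countable C" "A = \<Union>C"
      and E: "E \<subseteq> D" "countable E" "B = \<Union>E" using AB by blast
    have "c - B \<in> D" if "c \<in> C" for c
    proof -
      have "c - c \<inter> \<Union>E \<in> D"
        using that C E by (intro delta_ring_Diff[OF D] delta_ring_Int_countable_Union[OF D]) auto
      moreover have "c - c \<inter> \<Union>E = c - B" using E by blast
      ultimately show ?thesis by simp
    qed
    then have "(\<lambda>c. c - B) ` C \<subseteq> D" "countable ((\<lambda>c. c - B) ` C)"
      using C by auto
    moreover have "A - B = \<Union>((\<lambda>c. c - B) ` C)" using C by blast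
    ultimately show "A - B \<in> ?S" by blast
  next
    show "\<Union>X \<in> ?S" if "X \<subseteq> ?S" "countable X" for X using that by (rule Union)
  qed
  moreover have "D \<subseteq> ?S"
  proof
    fix A assume "A \<in> D"
    then have "{A} \<subseteq> D \<and> countable {A} \<and> A = \<Union>{A}" by simp
    then show "A \<in> ?S" by blast
  qed
  ultimately have "sigma_ring hull D \<subseteq> ?S" by (intro hull_minimal)
  then show thesis using A that by blast
qed

text \<open>The ideal property: \<open>B\<close> is a countable union of members of
  \<open>D\<close>, and cutting such a union down to \<open>A\<close> stays in
  \<open>D\<close>.\<close>

lemma delta_ring_Int_hull:
  assumes "delta_ring D" "A \<in> D" "B \<in> sigma_ring hull D"
  shows "A \<inter> B \<in> D"
  by (rule sigma_ring_hull_countable_Union[OF assms(1,3)])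
    (simp add: delta_ring_Int_countable_Union[OF assms(1,2)])

text \<open>If \<open>A\<close> is both \<open>\<Union>C\<close> with \<open>C \<subseteq> D\<close>
  and \<open>\<Union>F\<close> with \<open>F \<subseteq> E\<close>, it is the union of the countably
  many sets \<open>c \<inter> f\<close>. Both rings are ideals of \<open>Q\<close>, so each
  \<open>c \<inter> f\<close> lies in \<open>D\<close> and in \<open>E\<close>.\<close>

lemma sigma_ring_hull_delta_ring_Int:
  assumes D: "delta_ring D" "sigma_ring hull D = Q" and E: "delta_ring E" "sigma_ring hull E = Q"
  shows "sigma_ring hull (D \<inter> E) = Q"
proof
  show "sigma_ring hull (D \<inter> E) \<subseteq> Q" using hull_mono[OF Int_lower1] D(2) by metis
  show "Q \<subseteq> sigma_ring hull (D \<inter> E)"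
  proof
    fix A assume A: "A \<in> Q"
    obtain C where C: "C \<subseteq> D" "countable C" "A = \<Union>C"
      by (rule sigma_ring_hull_countable_Union[OF D(1)]) (use A D(2) in auto)
    obtain F where F: "F \<subseteq> E" "countable F" "A = \<Union>F"
      by (rule sigma_ring_hull_countable_Union[OF E(1)]) (use A E(2) in auto)
    have DQ: "D \<subseteq> Q" "E \<subseteq> Q" using hull_subset D(2) E(2) by metis+
    have "c \<inter> f \<in> sigma_ring hull (D \<inter> E)" if "c \<in> C" "f \<in> F" for c f
    proof (rule hull_inc, rule IntI)
      have "c \<in> D" "f \<in> E" "c \<in> Q" "f \<in> Q" using that C(1) F(1) DQ by auto
      then show "c \<inter> f \<in> D" "c \<inter> f \<in> E"
        using delta_ring_Int_hull[OF D(1), of c f] delta_ring_Int_hull[OF E(1), of f c]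
        by (simp_all add: D(2) E(2) Int_commute)
    qed
    then have "\<Union>((\<lambda>(c, f). c \<inter> f) ` (C \<times> F)) \<in> sigma_ring hull (D \<inter> E)"
      using C(2) F(2) by (intro sigma_ring_Union[OF sigma_ring_hull]) auto
    moreover have "\<Union>((\<lambda>(c, f). c \<inter> f) ` (C \<times> F)) = \<Union>C \<inter> \<Union>F" by auto
    ultimately show "A \<in> sigma_ring hull (D \<inter> E)" by (simp flip: C(3) F(3))
  qed
qed

lemma countable_partition_exists:
  assumes D: "delta_ring D" and A: "A \<in> sigma_ring hull D"
  obtains P :: "nat \<Rightarrow> _" where "is_partition D A UNIV P"
proof -
  obtain C where C: "C \<subseteq> D" "countable C" "A = \<Union>C"
    by (rule sigma_ring_hull_countable_Union[OF assms])
  \<comment> \<open>Adding the empty set makes the set to be enumerated nonempty, even when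
    \<open>C\<close> is empty, without changing the union.\<close>
  define P where "P = from_nat_into (insert {} C)"
  have P: "range P = insert {} C" unfolding P_def by (rule range_from_nat_into) (use C in auto)
  interpret ring_of_sets UNIV D using D by (simp add: delta_ring_def)
  have "is_partition D A UNIV (disjointed P)"
    unfolding is_partition_def
    using P C delta_ring_empty[OF D] range_disjointed_sets[of P] disjoint_family_disjointed[of P]
      UN_disjointed_eq[of P] by auto
  then show thesis by (rule that)
qed

section \<open>Similarity of premeasures\<close>

lemma premeasure_delta_ring: "premeasure \<mu> \<Longrightarrow> delta_ring (dom \<mu>)"
  by (simp add: premeasure_def)

lemma premeasure_has_sum:
  fixes I :: "nat set"
  assumes "premeasure \<mu>" "A \<in> dom \<mu>" "is_partition (dom \<mu>) A I P"
  shows "((\<lambda>i. the (\<mu> (P i))) has_sum the (\<mu> A)) I"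
  using assms unfolding premeasure_def by blast

lemma dom_subset_host: "dom \<mu> \<subseteq> host \<mu>"
  unfolding host_def by (rule hull_subset)

lemma sigma_ring_host: "sigma_ring (host \<mu>)"
  unfolding host_def by (rule sigma_ring_hull)

lemma host_eqI:
  assumes "dom \<mu> \<subseteq> dom \<nu>" "dom \<nu> \<subseteq> host \<mu>"
  shows "host \<nu> = host \<mu>"
proof
  show "host \<nu> \<subseteq> host \<mu>"
    using hull_minimal[of _ _ sigma_ring, OF assms(2) sigma_ring_host] by (simp add: host_def)
  show "host \<mu> \<subseteq> host \<nu>"
    using hull_mono[OF assms(1)] by (simp add: host_def)
qed

text \<open>The ring \<open>E\<close> of the traces may differ from the ring \<open>D\<close> of the
  pieces. This lets a partition from a joint domain be cut down to the domain of one
  premeasure.\<close>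

lemma is_partition_Int:
  assumes P: "is_partition D C I P" and "A \<subseteq> C" and "\<And>i. i \<in> I \<Longrightarrow> P i \<inter> A \<in> E"
  shows "is_partition E A I (\<lambda>i. P i \<inter> A)"
proof -
  have "disjoint_family_on (\<lambda>i. P i \<inter> A) I"
    using P unfolding is_partition_def disjoint_family_on_def by blast
  moreover have "(\<Union>i\<in>I. P i \<inter> A) = A"
    using assms(1,2) unfolding is_partition_def by blast
  ultimately show ?thesis using assms(3) unfolding is_partition_def by blast
qed

lemma premeasure_dom_ideal:
  assumes "premeasure \<mu>" "A \<in> dom \<mu>" "B \<in> host \<mu>"
  shows "A \<inter> B \<in> dom \<mu>" "B \<inter> A \<in> dom \<mu>"
  using delta_ring_Int_hull[OF premeasure_delta_ring] assms unfolding host_def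
  by (metis Int_commute)+

lemma premeasure_Un:
  assumes \<mu>: "premeasure \<mu>" and A: "A \<in> dom \<mu>" and B: "B \<in> dom \<mu>" and "A \<inter> B = {}"
  shows "the (\<mu> (A \<union> B)) = the (\<mu> A) + the (\<mu> B)"
proof -
  let ?P = "\<lambda>i::nat. if i = 0 then A else B"
  have "A \<union> B \<in> dom \<mu>" using delta_ring_Un[OF premeasure_delta_ring] assms by blast
  moreover have "is_partition (dom \<mu>) (A \<union> B) {0, 1} ?P"
    using assms unfolding is_partition_def disjoint_family_on_def by auto
  ultimately have "((\<lambda>i. the (\<mu> (?P i))) has_sum the (\<mu> (A \<union> B))) {0, 1}"
    by (rule premeasure_has_sum[OF \<mu>])
  from has_sum_unique[OF this has_sum_finite] show ?thesis by simp
qed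

text \<open>The cutting sets are only required to lie in the host: the ideal property puts the two
  pieces into the domain. So \<open>B\<close> or \<open>C\<close> may come from the domain of
  another premeasure with the same host.\<close>

lemma premeasure_split:
  assumes \<mu>: "premeasure \<mu>" and A: "A \<in> dom \<mu>" and BC: "B \<in> host \<mu>" "C \<in> host \<mu>"
    and "A \<subseteq> B \<union> C" "B \<inter> C = {}"
  shows "the (\<mu> A) = the (\<mu> (A \<inter> B)) + the (\<mu> (A \<inter> C))"
proof -
  have "A = A \<inter> B \<union> A \<inter> C" using assms by blast
  then show ?thesis
    using premeasure_Un[OF \<mu> premeasure_dom_ideal(1)[OF \<mu> A BC(1)] premeasure_dom_ideal(1)[OF \<mu> A BC(2)]]
      assms(6) by auto
qed

lemma similar_refl: "\<mu> \<asymp> \<mu>"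
  by (simp add: similar_def)

lemma similarD: "\<mu> \<asymp> \<nu> \<Longrightarrow> A \<in> dom \<mu> \<Longrightarrow> A \<in> dom \<nu> \<Longrightarrow> \<mu> A = \<nu> A"
  by (simp add: similar_def)

lemma similar_sym: "\<mu> \<asymp> \<nu> \<Longrightarrow> \<nu> \<asymp> \<mu>"
  by (auto simp: similar_def)

text \<open>On the triple intersection \<open>?E\<close> of the domains, \<mu> and \<kappa> agree
  through \<nu>. Since \<open>?E\<close> still generates the host, any common \<open>A\<close> has a
  countable partition into members of \<open>?E\<close>; both values at \<open>A\<close> are sums of
  the same family, and limits in a Hausdorff space are unique.\<close>

lemma similar_trans:
  assumes pre: "premeasure \<mu>" "premeasure \<nu>" "premeasure \<kappa>" and sim: "\<mu> \<asymp> \<nu>" "\<nu> \<asymp> \<kappa>"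
  shows "\<mu> \<asymp> \<kappa>"
proof -
  let ?E = "dom \<mu> \<inter> dom \<nu> \<inter> dom \<kappa>"
  have hosts: "host \<nu> = host \<mu>" "host \<kappa> = host \<mu>" using sim by (auto simp: similar_def)
  have E: "delta_ring ?E" using pre premeasure_delta_ring delta_ring_Int by metis
  have hull: "sigma_ring hull ?E = host \<mu>"
    by (intro sigma_ring_hull_delta_ring_Int delta_ring_Int premeasure_delta_ring pre)
      (use hosts in \<open>auto simp: host_def\<close>)
  have "\<mu> A = \<kappa> A" if A: "A \<in> dom \<mu>" "A \<in> dom \<kappa>" for A
  proof -
    obtain P :: "nat \<Rightarrow> _" where P: "is_partition ?E A UNIV P"
      using countable_partition_exists[OF E] hull A dom_subset_host[of \<mu>] by blast
    then have "is_partition (dom \<mu>) A UNIV P" "is_partition (dom \<kappa>) A UNIV P"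
      unfolding is_partition_def by auto
    from premeasure_has_sum[OF pre(1) A(1) this(1)] premeasure_has_sum[OF pre(3) A(2) this(2)]
    have "((\<lambda>i. the (\<mu> (P i))) has_sum the (\<mu> A)) UNIV"
      "((\<lambda>i. the (\<kappa> (P i))) has_sum the (\<kappa> A)) UNIV" .
    moreover have "\<mu> (P i) = \<kappa> (P i)" for i
    proof -
      have "P i \<in> ?E" using P unfolding is_partition_def by blast
      then show ?thesis using sim unfolding similar_def by auto
    qed
    ultimately have "the (\<mu> A) = the (\<kappa> A)" using has_sum_unique by simp
    then show ?thesis using A by auto
  qed
  then show ?thesis using hosts by (auto simp: similar_def)
qed

text \<open>The value at \<open>A \<union> B\<close> for disjoint \<open>A\<close> and
  \<open>B\<close> is the \<mu>-value of \<open>A\<close> plus the \<nu>-value of \<open>B\<close>.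
  Additivity holds because a partition of \<open>A \<union> B\<close> leaves traces on
  \<open>A\<close> and \<open>B\<close>, and the two convergent families of traces add
  termwise.\<close>

lemma premeasure_join:
  assumes \<mu>: "premeasure \<mu>" and \<nu>: "premeasure \<nu>" and sim: "\<mu> \<asymp> \<nu>"
  obtains \<kappa> where "premeasure \<kappa>" "\<kappa> \<asymp> \<mu>" "dom \<kappa> = {A \<union> B |A B. A \<in> dom \<mu> \<and> B \<in> dom \<nu>}"
proof -
  define Q where "Q = host \<mu>"
  have host: "host \<mu> = Q" "host \<nu> = Q" using sim by (auto simp: similar_def Q_def)
  have Q: "sigma_ring Q" unfolding Q_def by (rule sigma_ring_host)
  have DQ: "dom \<mu> \<subseteq> Q" "dom \<nu> \<subseteq> Q" using dom_subset_host host by metis+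
  have agree: "\<mu> A = \<nu> A" if "A \<in> dom \<mu>" "A \<in> dom \<nu>" for A
    using that sim by (auto simp: similar_def)
  note D = premeasure_delta_ring[OF \<mu>] and E = premeasure_delta_ring[OF \<nu>]
  note ideal = premeasure_dom_ideal[OF \<mu>, unfolded host] premeasure_dom_ideal[OF \<nu>, unfolded host]
  \<comment> \<open>\<open>R\<close> asks for disjoint parts, which the value needs, while
    \<open>J\<close> admits overlapping unions, which makes closure under unions immediate.
    Replacing \<open>B\<close> by \<open>B - A\<close> passes from one to the other.\<close>
  define R where "R C A B \<longleftrightarrow> A \<in> dom \<mu> \<and> B \<in> dom \<nu> \<and> A \<inter> B = {} \<and> C = A \<union> B" for C A B
  define J where "J = {A \<union> B |A B. A \<in> dom \<mu> \<and> B \<in> dom \<nu>}"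
  have JI: "A \<union> B \<in> J" if "A \<in> dom \<mu>" "B \<in> dom \<nu>" for A B
    using that unfolding J_def by blast
  have RJ: "\<exists>A B. R C A B" if C: "C \<in> J" for C
  proof -
    obtain A B where AB: "A \<in> dom \<mu>" "B \<in> dom \<nu>" "C = A \<union> B" using C unfolding J_def by blast
    have "B \<inter> (B - A) \<in> dom \<nu>" using AB DQ sigma_ring_Diff[OF Q] by (intro ideal) auto
    moreover have "B \<inter> (B - A) = B - A" by blast
    ultimately have "R C A (B - A)" unfolding R_def using AB by auto
    then show ?thesis by blast
  qed
  \<comment> \<open>The choice ranges over all disjoint representations of \<open>C\<close>;
    \<open>unique\<close> shows that they all give the same sum.\<close>
  define \<kappa> where "\<kappa> C = (if C \<in> J then Some (SOME s. \<exists>A B. R C A B \<and> s = the (\<mu> A) + the (\<nu> B))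
    else None)" for C
  have dom: "dom \<kappa> = J" unfolding \<kappa>_def by (auto simp: dom_def)
  \<comment> \<open>The two representations are compared through their common refinement into four
    pieces.\<close>
  have unique: "the (\<mu> A) + the (\<nu> B) = the (\<mu> A') + the (\<nu> B')"
    if R: "R C A B" "R C A' B'" for C A B A' B'
  proof -
    have mem: "A \<in> dom \<mu>" "A' \<in> dom \<mu>" "B \<in> dom \<nu>" "B' \<in> dom \<nu>" using R by (auto simp: R_def)
    then have memQ: "A \<in> Q" "A' \<in> Q" "B \<in> Q" "B' \<in> Q" using DQ by auto
    have "the (\<mu> A) = the (\<mu> (A \<inter> A')) + the (\<mu> (A \<inter> B'))"
      by (rule premeasure_split[OF \<mu>]) (use R mem memQ host in \<open>auto simp: R_def\<close>)
    moreover have "the (\<nu> B) = the (\<nu> (B \<inter> A')) + the (\<nu> (B \<inter> B'))"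
      by (rule premeasure_split[OF \<nu>]) (use R mem memQ host in \<open>auto simp: R_def\<close>)
    moreover have "the (\<mu> A') = the (\<mu> (A' \<inter> A)) + the (\<mu> (A' \<inter> B))"
      by (rule premeasure_split[OF \<mu>]) (use R mem memQ host in \<open>auto simp: R_def\<close>)
    moreover have "the (\<nu> B') = the (\<nu> (B' \<inter> A)) + the (\<nu> (B' \<inter> B))"
      by (rule premeasure_split[OF \<nu>]) (use R mem memQ host in \<open>auto simp: R_def\<close>)
    \<comment> \<open>The mixed pieces belong to both domains by the ideal property, so it does not
      matter which premeasure evaluates them.\<close>
    moreover have "\<mu> (A \<inter> B') = \<nu> (A \<inter> B')" "\<mu> (A' \<inter> B) = \<nu> (A' \<inter> B)"
      using agree ideal(1)[OF mem(1) memQ(4)] ideal(4)[OF mem(4) memQ(1)]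
        ideal(1)[OF mem(2) memQ(3)] ideal(4)[OF mem(3) memQ(2)] by blast+
    ultimately show ?thesis by (simp add: Int_commute add_ac)
  qed
  have \<kappa>: "the (\<kappa> C) = the (\<mu> A) + the (\<nu> B)" if R: "R C A B" for C A B
  proof -
    have "C \<in> J" using R JI unfolding R_def by simp
    moreover have "(SOME s. \<exists>A B. R C A B \<and> s = the (\<mu> A) + the (\<nu> B)) = the (\<mu> A) + the (\<nu> B)"
      by (rule some_equality) (use R unique in blast)+
    ultimately show ?thesis by (simp add: \<kappa>_def)
  qed
  have JQ: "J \<subseteq> Q" unfolding J_def using DQ by (auto intro!: sigma_ring_Un[OF Q])
  have "delta_ring J"
  proof (rule delta_ring_ideal[OF Q JQ])
    show "{} \<in> J" using JI[OF delta_ring_empty[OF D] delta_ring_empty[OF E]] by simp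
  next
    fix C C' assume "C \<in> J" "C' \<in> J"
    then obtain A B A' B' where "A \<in> dom \<mu>" "B \<in> dom \<nu>" "C = A \<union> B" "A' \<in> dom \<mu>" "B' \<in> dom \<nu>" "C' = A' \<union> B'"
      unfolding J_def by blast
    then have "(A \<union> A') \<union> (B \<union> B') \<in> J"
      by (intro JI delta_ring_Un[OF D] delta_ring_Un[OF E])
    moreover have "C \<union> C' = (A \<union> A') \<union> (B \<union> B')"
      using \<open>C = A \<union> B\<close> \<open>C' = A' \<union> B'\<close> by blast
    ultimately show "C \<union> C' \<in> J" by simp
  next
    fix C C' assume C: "C \<in> J" "C' \<in> Q" "C' \<subseteq> C"
    then obtain A B where AB: "A \<in> dom \<mu>" "B \<in> dom \<nu>" "C = A \<union> B"
      unfolding J_def by blast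
    have "(A \<inter> C') \<union> (B \<inter> C') \<in> J"
      by (rule JI[OF ideal(1)[OF AB(1) C(2)] ideal(3)[OF AB(2) C(2)]])
    moreover have "C' = (A \<inter> C') \<union> (B \<inter> C')" using AB(3) C(3) by blast
    ultimately show "C' \<in> J" by simp
  qed
  moreover have "((\<lambda>i. the (\<kappa> (P i))) has_sum the (\<kappa> C)) I"
    if C: "C \<in> J" and P: "is_partition J C I P" for C P and I :: "nat set"
  proof -
    obtain A B where R: "R C A B" using RJ C by blast
    then have AB: "A \<in> dom \<mu>" "B \<in> dom \<nu>" by (auto simp: R_def)
    have "P i \<in> Q" if "i \<in> I" for i using P that JQ unfolding is_partition_def by blast
    then have mem: "P i \<inter> A \<in> dom \<mu>" "P i \<inter> B \<in> dom \<nu>" if "i \<in> I" for i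
      using ideal(2)[OF AB(1)] ideal(4)[OF AB(2)] that by simp_all
    have sub: "A \<subseteq> C" "B \<subseteq> C" "A \<inter> B = {}" using R unfolding R_def by auto
    have "is_partition (dom \<mu>) A I (\<lambda>i. P i \<inter> A)" "is_partition (dom \<nu>) B I (\<lambda>i. P i \<inter> B)"
      using is_partition_Int[OF P] sub mem by metis+
    then have "((\<lambda>i. the (\<mu> (P i \<inter> A)) + the (\<nu> (P i \<inter> B))) has_sum the (\<mu> A) + the (\<nu> B)) I"
      by (intro has_sum_add premeasure_has_sum \<mu> \<nu> AB)
    moreover have "the (\<kappa> (P i)) = the (\<mu> (P i \<inter> A)) + the (\<nu> (P i \<inter> B))" if "i \<in> I" for i
    proof (rule \<kappa>)
      show "R (P i) (P i \<inter> A) (P i \<inter> B)"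
        unfolding R_def
      proof (intro conjI mem that)
        have "P i \<subseteq> A \<union> B" using P R that unfolding is_partition_def R_def by blast
        then show "P i = P i \<inter> A \<union> P i \<inter> B" by blast
        show "P i \<inter> A \<inter> (P i \<inter> B) = {}" using sub(3) by blast
      qed
    qed
    ultimately show ?thesis unfolding \<kappa>[OF R] by (simp cong: has_sum_cong)
  qed
  ultimately have "premeasure \<kappa>"
    unfolding premeasure_def dom by (intro conjI ballI allI impI)
  moreover have "\<kappa> \<asymp> \<mu>"
    unfolding similar_def
  proof
    have "dom \<mu> \<subseteq> J"
    proof
      fix A assume "A \<in> dom \<mu>"
      then show "A \<in> J" using JI[OF _ delta_ring_empty[OF E], of A] by simp
    qed
    then show "host \<kappa> = host \<mu>" using JQ by (intro host_eqI) (simp_all add: dom host(1))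
    show "\<forall>A\<in>dom \<kappa> \<inter> dom \<mu>. \<kappa> A = \<mu> A"
    proof
      fix A assume A: "A \<in> dom \<kappa> \<inter> dom \<mu>"
      \<comment> \<open>The representation of \<open>A\<close> as \<open>A \<union> {}\<close> is
        admissible since both domains contain the empty set.\<close>
      have e: "{} \<in> dom \<mu>" "{} \<in> dom \<nu>" using delta_ring_empty D E by auto
      then have "R A A {}" using A by (simp add: R_def)
      from \<kappa>[OF this] have "the (\<kappa> A) = the (\<mu> A) + the (\<mu> {})" using agree e by simp
      \<comment> \<open>Additivity for \<open>A\<close> and \<open>{}\<close> absorbs the second
        summand, so no cancellation in the monoid is invoked.\<close>
      also have "\<dots> = the (\<mu> A)" using premeasure_Un[OF \<mu>, of A "{}"] A e by simp
      finally show "\<kappa> A = \<mu> A" using A by auto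
    qed
  qed
  ultimately show thesis using dom unfolding J_def by (rule that)
qed

section \<open>The measure similar to a premeasure\<close>

text \<open>The measure is the union \<kappa> of the class \<open>F\<close> of all premeasures
  similar to \<mu>. It is maximal because a premeasure similar to \<kappa> is, by transitivity,
  again a member of \<open>F\<close>.\<close>

lemma measure_exists:
  assumes \<mu>: "premeasure \<mu>"
  obtains \<nu> where "is_measure \<nu>" "\<nu> \<asymp> \<mu>"
proof -
  define F where "F = {\<nu>. premeasure \<nu> \<and> \<nu> \<asymp> \<mu>}"
  define \<kappa> where "\<kappa> A = (if A \<in> \<Union>(dom ` F) then (SOME \<nu>. \<nu> \<in> F \<and> A \<in> dom \<nu>) A else None)" for A
  define Q where "Q = host \<mu>"
  have Q: "sigma_ring Q" unfolding Q_def by (rule sigma_ring_host)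
  have F: "premeasure \<nu>" "\<nu> \<asymp> \<mu>" "host \<nu> = Q" "dom \<nu> \<subseteq> Q" if "\<nu> \<in> F" for \<nu>
    using that dom_subset_host[of \<nu>] by (auto simp: F_def similar_def Q_def)
  have \<mu>F: "\<mu> \<in> F" using \<mu> by (simp add: F_def similar_refl)
  \<comment> \<open>Members of \<open>F\<close> are compared through \<mu>. Their pairwise
    similarity makes the choice in \<kappa> immaterial.\<close>
  have FF: "\<nu> \<asymp> \<nu>'" if "\<nu> \<in> F" "\<nu>' \<in> F" for \<nu> \<nu>'
    by (rule similar_trans[OF F(1)[OF that(1)] \<mu> F(1)[OF that(2)] F(2)[OF that(1)]
      similar_sym[OF F(2)[OF that(2)]]])
  have \<kappa>: "\<kappa> A = \<nu> A" if "\<nu> \<in> F" "A \<in> dom \<nu>" for A \<nu>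
  proof -
    let ?\<nu>' = "SOME \<nu>. \<nu> \<in> F \<and> A \<in> dom \<nu>"
    have "?\<nu>' \<in> F \<and> A \<in> dom ?\<nu>'" by (rule someI[of _ \<nu>]) (use that in simp)
    then have "?\<nu>' A = \<nu> A" using similarD[OF FF, of ?\<nu>' \<nu>] that by simp
    moreover have "A \<in> \<Union>(dom ` F)" using that by blast
    ultimately show ?thesis unfolding \<kappa>_def by simp
  qed
  have dom: "dom \<kappa> = \<Union>(dom ` F)"
  proof
    show "dom \<kappa> \<subseteq> \<Union>(dom ` F)" unfolding \<kappa>_def by (auto split: if_splits)
    show "\<Union>(dom ` F) \<subseteq> dom \<kappa>"
    proof
      fix A assume "A \<in> \<Union>(dom ` F)"
      then obtain \<nu> where "\<nu> \<in> F" "A \<in> dom \<nu>" by blast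
      then show "A \<in> dom \<kappa>" using \<kappa>[of \<nu> A] by (simp add: domIff)
    qed
  qed
  have ideal: "B \<in> dom \<nu>" if "\<nu> \<in> F" "A \<in> dom \<nu>" "B \<in> Q" "B \<subseteq> A" for A B \<nu>
  proof -
    have "A \<inter> B \<in> dom \<nu>" using that F by (intro premeasure_dom_ideal) auto
    then show ?thesis using that by (simp add: Int_absorb1)
  qed
  have domQ: "dom \<kappa> \<subseteq> Q" unfolding dom using F by blast
  have \<mu>\<kappa>: "dom \<mu> \<subseteq> dom \<kappa>" unfolding dom using \<mu>F by blast
  have "delta_ring (dom \<kappa>)"
  proof (rule delta_ring_ideal[OF Q domQ])
    show "{} \<in> dom \<kappa>" using \<mu>\<kappa> delta_ring_empty[OF premeasure_delta_ring[OF \<mu>]] by blast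
  next
    fix A B assume "A \<in> dom \<kappa>" "B \<in> dom \<kappa>"
    then obtain \<nu> \<nu>' where \<nu>: "\<nu> \<in> F" "\<nu>' \<in> F" "A \<in> dom \<nu>" "B \<in> dom \<nu>'" unfolding dom by blast
    \<comment> \<open>\<open>A\<close> and \<open>B\<close> may come from different members of
      \<open>F\<close>; the join is a single member whose domain contains
      \<open>A \<union> B\<close>.\<close>
    obtain \<rho> where \<rho>: "premeasure \<rho>" "\<rho> \<asymp> \<nu>" "dom \<rho> = {A \<union> B |A B. A \<in> dom \<nu> \<and> B \<in> dom \<nu>'}"
      using premeasure_join[OF F(1)[OF \<nu>(1)] F(1)[OF \<nu>(2)] FF[OF \<nu>(1,2)]] .
    then have "\<rho> \<in> F"
      using similar_trans[OF \<rho>(1) F(1)[OF \<nu>(1)] \<mu> \<rho>(2) F(2)[OF \<nu>(1)]] by (simp add: F_def)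
    moreover have "A \<union> B \<in> dom \<rho>" unfolding \<rho>(3) using \<nu>(3,4) by blast
    ultimately show "A \<union> B \<in> dom \<kappa>" unfolding dom by blast
  next
    fix A B assume AB: "A \<in> dom \<kappa>" "B \<in> Q" "B \<subseteq> A"
    then obtain \<nu> where \<nu>: "\<nu> \<in> F" "A \<in> dom \<nu>" unfolding dom by blast
    have "B \<in> dom \<nu>" by (rule ideal[OF \<nu> AB(2,3)])
    then show "B \<in> dom \<kappa>" unfolding dom using \<nu>(1) by blast
  qed
  moreover have "((\<lambda>i. the (\<kappa> (P i))) has_sum the (\<kappa> A)) I"
    if A: "A \<in> dom \<kappa>" and P: "is_partition (dom \<kappa>) A I P" for A P and I :: "nat set"
  proof -
    obtain \<nu> where \<nu>: "\<nu> \<in> F" "A \<in> dom \<nu>" using A unfolding dom by blast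
    \<comment> \<open>The pieces are members of the host contained in \<open>A\<close>, so the ideal
      property puts all of them into the domain of the one \<nu> that contains \<open>A\<close>.
      Summability is then inherited from \<nu> alone.\<close>
    have Pi: "P i \<in> dom \<nu>" if "i \<in> I" for i
    proof (rule ideal[OF \<nu>])
      show "P i \<in> Q" "P i \<subseteq> A" using P domQ that unfolding is_partition_def by blast+
    qed
    then have "is_partition (dom \<nu>) A I P" using P unfolding is_partition_def by blast
    then have "((\<lambda>i. the (\<nu> (P i))) has_sum the (\<nu> A)) I"
      by (intro premeasure_has_sum F \<nu>)
    then show ?thesis unfolding \<kappa>[OF \<nu>] using \<kappa>[OF \<nu>(1) Pi] by (simp cong: has_sum_cong)
  qed
  ultimately have pre: "premeasure \<kappa>"
    unfolding premeasure_def by (intro conjI ballI allI impI)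
  have sim: "\<kappa> \<asymp> \<mu>"
    unfolding similar_def
  proof
    show "host \<kappa> = host \<mu>" using \<mu>\<kappa> domQ unfolding Q_def by (rule host_eqI)
    show "\<forall>A\<in>dom \<kappa> \<inter> dom \<mu>. \<kappa> A = \<mu> A" using \<kappa>[OF \<mu>F] by simp
  qed
  have "\<nu> \<subseteq>\<^sub>m \<kappa>" if "premeasure \<nu>" "\<nu> \<asymp> \<kappa>" for \<nu>
  proof -
    have "\<nu> \<in> F" using similar_trans[OF that(1) pre \<mu> that(2) sim] that(1) by (simp add: F_def)
    then show ?thesis using \<kappa> unfolding map_le_def by simp
  qed
  then have "is_measure \<kappa>" unfolding is_measure_def using pre by simp
  then show thesis using sim by (rule that)
qed

text \<open>Both measures are similar to each other through \<mu>, so by maximality each extends the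
  other.\<close>

lemma measure_unique:
  assumes "premeasure \<mu>" "is_measure \<nu>" "\<nu> \<asymp> \<mu>" "is_measure \<nu>'" "\<nu>' \<asymp> \<mu>"
  shows "\<nu> = \<nu>'"
proof -
  have pre: "premeasure \<nu>" "premeasure \<nu>'" using assms by (simp_all add: is_measure_def)
  have sim: "\<nu> \<asymp> \<nu>'"
    by (rule similar_trans[OF pre(1) assms(1) pre(2) assms(3) similar_sym[OF assms(5)]])
  have "\<nu> \<subseteq>\<^sub>m \<nu>'" "\<nu>' \<subseteq>\<^sub>m \<nu>"
    using assms(2,4) pre sim similar_sym[OF sim] unfolding is_measure_def by simp_all
  then show ?thesis by (rule map_le_antisym)
qed

text \<open>This resolves the definite description in \<open>measure_ext\<close>: exhibiting one
  measure similar to \<mu> is enough to compute it.\<close>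

lemma measure_ext_eqI:
  assumes "premeasure \<mu>" "is_measure \<nu>" "\<nu> \<asymp> \<mu>"
  shows "measure_ext \<mu> = \<nu>"
  unfolding measure_ext_def
proof (rule the_equality)
  show "is_measure \<nu> \<and> \<nu> \<asymp> \<mu>" using assms(2,3) ..
  show "\<nu>' = \<nu>" if "is_measure \<nu>' \<and> \<nu>' \<asymp> \<mu>" for \<nu>'
    using measure_unique[OF assms(1) _ _ assms(2,3)] that by blast
qed

lemma measure_ext:
  assumes "premeasure \<mu>"
  shows "is_measure (measure_ext \<mu>)" "measure_ext \<mu> \<asymp> \<mu>"
proof -
  obtain \<nu> where "is_measure \<nu>" "\<nu> \<asymp> \<mu>" by (rule measure_exists[OF assms])
  then show "is_measure (measure_ext \<mu>)" "measure_ext \<mu> \<asymp> \<mu>"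
    by (simp_all add: measure_ext_eqI[OF assms])
qed

section \<open>Addition of measures\<close>

lemma dom_pointwise_add: "dom (pointwise_add \<mu> \<nu>) = dom \<mu> \<inter> dom \<nu>"
  unfolding pointwise_add_def by (auto simp: dom_def)

lemma pointwise_add_apply:
  "A \<in> dom \<mu> \<Longrightarrow> A \<in> dom \<nu> \<Longrightarrow> pointwise_add \<mu> \<nu> A = Some (the (\<mu> A) + the (\<nu> A))"
  unfolding pointwise_add_def by auto

lemma pointwise_add_commute:
  "pointwise_add \<mu> \<nu> = pointwise_add \<nu> (\<mu> :: _ \<rightharpoonup> 'a::ab_semigroup_add)"
  unfolding pointwise_add_def by (auto simp: fun_eq_iff add.commute)

lemma pointwise_add_assoc:
  "pointwise_add (pointwise_add \<mu> \<nu>) \<kappa> = pointwise_add \<mu> (pointwise_add \<nu> (\<kappa> :: _ \<rightharpoonup> 'a::semigroup_add))"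
proof
  fix A
  show "pointwise_add (pointwise_add \<mu> \<nu>) \<kappa> A = pointwise_add \<mu> (pointwise_add \<nu> \<kappa>) A"
    by (cases "\<mu> A"; cases "\<nu> A"; cases "\<kappa> A") (auto simp: pointwise_add_def dom_def add.assoc)
qed

lemma pointwise_add_zero_on:
  assumes "dom \<mu> \<subseteq> Q"
  shows "pointwise_add (zero_on Q) \<mu> = (\<mu> :: _ \<rightharpoonup> 'a::monoid_add)"
proof
  fix A
  show "pointwise_add (zero_on Q) \<mu> A = \<mu> A"
    using assms by (cases "\<mu> A") (auto simp: pointwise_add_def zero_on_def dom_def)
qed

text \<open>The domain of the sum is an intersection of two \<delta>-rings generating
  \<open>Q\<close>, which still generates \<open>Q\<close>.\<close>

lemma host_pointwise_add:
  assumes "premeasure \<mu>" "premeasure \<nu>" "host \<mu> = Q" "host \<nu> = Q"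
  shows "host (pointwise_add \<mu> \<nu>) = Q"
  using assms sigma_ring_hull_delta_ring_Int[of "dom \<mu>" Q "dom \<nu>"]
  by (simp add: host_def dom_pointwise_add premeasure_delta_ring)

lemma premeasure_pointwise_add:
  assumes \<mu>: "premeasure \<mu>" and \<nu>: "premeasure \<nu>"
  shows "premeasure (pointwise_add \<mu> \<nu>)"
  unfolding premeasure_def dom_pointwise_add
proof (intro conjI ballI allI impI)
  show "delta_ring (dom \<mu> \<inter> dom \<nu>)" by (intro delta_ring_Int premeasure_delta_ring \<mu> \<nu>)
next
  fix A P and I :: "nat set"
  assume A: "A \<in> dom \<mu> \<inter> dom \<nu>" and P: "is_partition (dom \<mu> \<inter> dom \<nu>) A I P"
  have "((\<lambda>i. the (\<mu> (P i)) + the (\<nu> (P i))) has_sum the (\<mu> A) + the (\<nu> A)) I"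
    by (intro has_sum_add premeasure_has_sum \<mu> \<nu>) (use A P in \<open>auto simp: is_partition_def\<close>)
  moreover have "the (pointwise_add \<mu> \<nu> (P i)) = the (\<mu> (P i)) + the (\<nu> (P i))" if "i \<in> I" for i
  proof -
    have "P i \<in> dom \<mu> \<inter> dom \<nu>" using that P unfolding is_partition_def by blast
    then show ?thesis by (simp add: pointwise_add_apply)
  qed
  ultimately show "((\<lambda>i. the (pointwise_add \<mu> \<nu> (P i))) has_sum the (pointwise_add \<mu> \<nu> A)) I"
    unfolding pointwise_add_apply[OF IntD1[OF A] IntD2[OF A]] option.sel by (simp cong: has_sum_cong)
qed

text \<open>This lets a summand be exchanged for a similar one, in particular
  \<open>measure_add\<close> for the pointwise sum inside a longer sum. Equal hosts ensure that the
  intersected domains still generate the same \<sigma>-ring.\<close>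

lemma similar_pointwise_add:
  assumes "premeasure \<mu>" "premeasure \<mu>'" "premeasure \<nu>" "\<mu> \<asymp> \<mu>'" "host \<nu> = host \<mu>"
  shows "pointwise_add \<mu> \<nu> \<asymp> pointwise_add \<mu>' \<nu>"
proof -
  have "host (pointwise_add \<mu> \<nu>) = host \<mu>" "host (pointwise_add \<mu>' \<nu>) = host \<mu>"
    using assms by (intro host_pointwise_add; simp add: similar_def)+
  then show ?thesis
    using similarD[OF assms(4)]
    by (simp add: similar_def dom_pointwise_add pointwise_add_apply)
qed

lemma measure_add_similar:
  assumes "premeasure \<mu>" "premeasure \<nu>"
  shows "is_measure (measure_add \<mu> \<nu>)" "measure_add \<mu> \<nu> \<asymp> pointwise_add \<mu> \<nu>"
  unfolding measure_add_def by (intro measure_ext premeasure_pointwise_add assms)+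

lemma host_measuresD:
  assumes "\<mu> \<in> host_measures Q"
  shows "premeasure \<mu>" "is_measure \<mu>" "host \<mu> = Q"
  using assms by (auto simp: host_measures_def is_measure_def)

lemma measure_add_closed:
  assumes "\<mu> \<in> host_measures Q" "\<nu> \<in> host_measures Q"
  shows "measure_add \<mu> \<nu> \<in> host_measures Q"
proof -
  note pre = assms[THEN host_measuresD(1)] and host = assms[THEN host_measuresD(3)]
  have "host (measure_add \<mu> \<nu>) = Q"
    using measure_add_similar(2)[OF pre] host_pointwise_add[OF pre host] by (simp add: similar_def)
  then show ?thesis using measure_add_similar(1)[OF pre] by (simp add: host_measures_def)
qed

lemma measure_add_commute: "measure_add \<mu> \<nu> = measure_add \<nu> \<mu>"
  unfolding measure_add_def by (simp add: pointwise_add_commute)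

text \<open>Both sides are measures similar to the same triple pointwise sum, which is a premeasure,
  so uniqueness identifies them.\<close>

lemma measure_add_assoc:
  assumes \<mu>: "\<mu> \<in> host_measures Q" and \<nu>: "\<nu> \<in> host_measures Q" and \<kappa>: "\<kappa> \<in> host_measures Q"
  shows "measure_add (measure_add \<mu> \<nu>) \<kappa> = measure_add \<mu> (measure_add \<nu> \<kappa>)"
proof -
  let ?s = "\<lambda>\<mu> \<nu> \<kappa>. pointwise_add (pointwise_add \<mu> \<nu>) \<kappa>"
  \<comment> \<open>Stated for arbitrary measures, since it is applied to the given triple and to
    its cyclic rotation.\<close>
  have sim: "measure_add (measure_add \<mu> \<nu>) \<kappa> \<asymp> ?s \<mu> \<nu> \<kappa>"
    if "\<mu> \<in> host_measures Q" "\<nu> \<in> host_measures Q" "\<kappa> \<in> host_measures Q" for \<mu> \<nu> \<kappa>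
  proof -
    note add = measure_add_closed[OF that(1,2)]
    note pre = that[THEN host_measuresD(1)] host_measuresD(1)[OF add]
    have "pointwise_add (measure_add \<mu> \<nu>) \<kappa> \<asymp> ?s \<mu> \<nu> \<kappa>"
      using host_measuresD(3) add that
      by (intro similar_pointwise_add measure_add_similar premeasure_pointwise_add pre) auto
    with measure_add_similar(2)[OF pre(4,3)] show ?thesis
      by (rule similar_trans[rotated 3])
        (intro host_measuresD(1)[OF measure_add_closed[OF add that(3)]] premeasure_pointwise_add pre)+
  qed
  \<comment> \<open>The rotated sum brackets \<nu> and \<kappa> first, so the right-hand side is
    reached by commutativity without a second similarity argument.\<close>
  have "?s \<nu> \<kappa> \<mu> = ?s \<mu> \<nu> \<kappa>"
    by (metis pointwise_add_assoc pointwise_add_commute)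
  then have "measure_add (measure_add \<nu> \<kappa>) \<mu> \<asymp> ?s \<mu> \<nu> \<kappa>" using sim[OF \<nu> \<kappa> \<mu>] by simp
  then have "measure_add (measure_add \<mu> \<nu>) \<kappa> = measure_add (measure_add \<nu> \<kappa>) \<mu>"
    using assms
    by (intro measure_unique[OF _ _ sim[OF \<mu> \<nu> \<kappa>]] premeasure_pointwise_add measure_add_similar(1))
      (auto intro: host_measuresD(1) measure_add_closed)
  then show ?thesis by (simp add: measure_add_commute)
qed

text \<open>Maximality is automatic: the domain is already the whole host, so every similar map has
  its domain inside \<open>Q\<close> and vanishes there.\<close>

lemma zero_on_host_measures:
  assumes Q: "sigma_ring Q"
  shows "(zero_on Q :: 'b set \<rightharpoonup> 'a::{topological_comm_monoid_add, t2_space}) \<in> host_measures Q"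
    (is "?z \<in> _")
proof -
  have dom: "dom ?z = Q" by (auto simp: zero_on_def dom_def)
  have host: "host ?z = Q" unfolding host_def dom using Q by (rule hull_same)
  have "((\<lambda>i. the (?z (P i))) has_sum the (?z A)) I"
    if "A \<in> Q" "is_partition Q A I P" for A P and I :: "nat set"
  proof -
    have "P i \<in> Q" if "i \<in> I" for i
      using that \<open>is_partition Q A I P\<close> unfolding is_partition_def by blast
    then show ?thesis using \<open>A \<in> Q\<close> by (simp add: zero_on_def has_sum_0)
  qed
  then have "premeasure ?z"
    unfolding premeasure_def dom using sigma_ring_imp_delta_ring[OF Q] by blast
  moreover have "\<nu> \<subseteq>\<^sub>m ?z" if "\<nu> \<asymp> ?z" for \<nu>
    using that dom_subset_host[of \<nu>] host dom unfolding similar_def map_le_def by blast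
  ultimately show ?thesis using host by (simp add: host_measures_def is_measure_def)
qed

text \<open>The domain of \<mu> lies in \<open>Q\<close>, so the pointwise sum with zero is \<mu>
  itself, and a measure is its own measure extension.\<close>

lemma measure_add_zero_on:
  assumes \<mu>: "\<mu> \<in> host_measures Q"
  shows "measure_add (zero_on Q) \<mu> = \<mu>"
proof -
  have "dom \<mu> \<subseteq> Q" using dom_subset_host[of \<mu>] host_measuresD(3)[OF \<mu>] by simp
  then show ?thesis
    unfolding measure_add_def
    by (simp add: pointwise_add_zero_on measure_ext_eqI host_measuresD[OF \<mu>] similar_refl)
qed

theorem proposition7p3:
  fixes Q :: "'b set set"
  assumes "sigma_ring Q"
  shows "Group.comm_monoid
    \<lparr>carrier = (host_measures Q :: ('b set \<rightharpoonup> 'a::{topological_comm_monoid_add, t2_space}) set),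
     mult = measure_add, one = zero_on Q\<rparr>"
  by (rule comm_monoidI, simp_all add: measure_add_closed zero_on_host_measures[OF assms]
    measure_add_assoc measure_add_zero_on) (rule measure_add_commute)

end
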